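(* Let $f:\mathbb{R}^n\to\mathbb{R}^n$ be a $C^3$ function with $f(x^* )=0$, and let $\hat r\in(0,1)$. If $f'(x^* )$ is nonsingular, then there exist a $\rho>0$ and constants $C_1$ and $C_2$ depending only on $f$ such that, whenever $x_k,x_{k-1}\in B_\rho(x^* )$, $\|e_k\|<\|e_{k-1}\|$ and $\eta_{k+1}<\hat r$, the iterate $x_{k+1}$ produced from $x_k,x_{k-1}$ by the adaptive $\gamma$-safeguarded Newton-Anderson step with parameter $\hat r$ satisfies $$\|e_{k+1}\|\le\left(\frac{C_1}{1-\hat r^2}+C_2\right)\|e_k\|^2.$$
   Context: $\|\cdot\|$ is the Euclidean norm and $B_\rho(x)$ is the ball of radius $\rho$ centered at $x$. Write $e_j=x_j-x^*$ and $w_{j+1}=-f'(x_j)^{-1}f(x_j)$. The adaptive $\gamma$-safeguarded Newton-Anderson step with parameter $\hat r\in(0,1)$ is defined, given $x_k,x_{k-1}$, as follows: - $\gamma_{k+1}=(w_{k+1}-w_k)^Tw_{k+1}/\|w_{k+1}-w_k\|^2$; - $\eta_{k+1}=\|w_{k+1}\|/\|w_k\|$, $r_{k+1}=\min\{\eta_{k+1},\hat r\}$, $\beta_{k+1}=r_{k+1}\eta_{k+1}$; - if $\gamma_{k+1}=0$ or $\gamma_{k+1}\ge 1$, set $\lambda_{k+1}=0$; else if $|\gamma_{k+1}|/|1-\gamma_{k+1}|>\beta_{k+1}$, set $\lambda_{k+1}=\dfrac{\beta_{k+1}}{\gamma_{k+1}(\beta_{k+1}+\operatorname{sign}(\gamma_{k+1}))}$;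 otherwise set $\lambda_{k+1}=1$; - $x_{k+1}=x_k+w_{k+1}-\lambda_{k+1}\gamma_{k+1}(x_k-x_{k-1}+w_{k+1}-w_k)$. *)

theory Defs
  imports "HOL-Analysis.Analysis"
begin

text \<open>
  \<open>C_diff k f\<close> says that \<open>f\<close> is of class \<open>C\<^sup>k\<close> on the whole space. Higher derivatives would change
  the codomain in the recursion, so the step is expressed through the maps \<open>x \<mapsto> f'(x) v\<close> for
  all fixed directions \<open>v\<close>; in finite dimension this is the usual notion.
\<close>

primrec C_diff :: "nat \<Rightarrow> ('a::euclidean_space \<Rightarrow> 'b::euclidean_space) \<Rightarrow> bool" where
  "C_diff 0 f \<longleftrightarrow> continuous_on UNIV f"
| "C_diff (Suc k) f \<longleftrightarrow>
     (\<forall>x. f differentiable (at x)) \<and> (\<forall>v. C_diff k (\<lambda>x. frechet_derivative f (at x) v))"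

text \<open>
  In the definitions below \<open>x\<close> is the current iterate \<open>x\<^sub>k\<close> and \<open>y\<close> the previous one \<open>x\<^sub>k\<^sub>-\<^sub>1\<close>;
  thus \<open>newton_update f x\<close> is \<open>w\<^sub>k\<^sub>+\<^sub>1\<close> and \<open>newton_update f y\<close> is \<open>w\<^sub>k\<close>.
\<close>

definition newton_update :: "(real^'n \<Rightarrow> real^'n) \<Rightarrow> real^'n \<Rightarrow> real^'n" where
  "newton_update f x = - (matrix_inv (jacobian f (at x)) *v f x)"

definition na_gamma :: "(real^'n \<Rightarrow> real^'n) \<Rightarrow> real^'n \<Rightarrow> real^'n \<Rightarrow> real" where
  "na_gamma f x y =
     ((newton_update f x - newton_update f y) \<bullet> newton_update f x)
       / (norm (newton_update f x - newton_update f y))\<^sup>2"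

definition na_eta :: "(real^'n \<Rightarrow> real^'n) \<Rightarrow> real^'n \<Rightarrow> real^'n \<Rightarrow> real" where
  "na_eta f x y = norm (newton_update f x) / norm (newton_update f y)"

definition na_beta :: "real \<Rightarrow> (real^'n \<Rightarrow> real^'n) \<Rightarrow> real^'n \<Rightarrow> real^'n \<Rightarrow> real" where
  "na_beta rhat f x y = min (na_eta f x y) rhat * na_eta f x y"

definition safeguard_lambda :: "real \<Rightarrow> real \<Rightarrow> real" where
  "safeguard_lambda \<beta> \<gamma> =
     (if \<gamma> = 0 \<or> \<gamma> \<ge> 1 then 0
      else if \<bar>\<gamma>\<bar> / \<bar>1 - \<gamma>\<bar> > \<beta> then \<beta> / (\<gamma> * (\<beta> + sgn \<gamma>))
      else 1)"

definition na_lambda :: "real \<Rightarrow> (real^'n \<Rightarrow> real^'n) \<Rightarrow> real^'n \<Rightarrow> real^'n \<Rightarrow> real" where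
  "na_lambda rhat f x y = safeguard_lambda (na_beta rhat f x y) (na_gamma f x y)"

definition safeguarded_na_step ::
    "real \<Rightarrow> (real^'n \<Rightarrow> real^'n) \<Rightarrow> real^'n \<Rightarrow> real^'n \<Rightarrow> real^'n" where
  "safeguarded_na_step rhat f x y =
     x + newton_update f x
       - (na_lambda rhat f x y * na_gamma f x y)
           *\<^sub>R (x - y + newton_update f x - newton_update f y)"

end

theory Submission
  imports Defs
begin

text \<open>
  The displacement \<open>h x = x + newton_update f x - xstar\<close> is the error of the plain Newton step
  from \<open>x\<close>, so near a nondegenerate zero it is of size \<open>norm (x - xstar)\<^sup>2\<close>
  (\<open>newton_error_quadratic\<close>). Write \<open>e = x - xstar\<close> and \<open>d = y - xstar\<close>. The safeguarded step has
  error \<open>h x - \<lambda>\<gamma> (h x - h y)\<close>, and two facts show that the second summand is also of order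
  \<open>(norm e)\<^sup>2\<close>.

  The vector \<open>h x - h y\<close> is estimated by the triangle inequality alone: as \<open>norm e < norm d\<close>, it
  has size at most a constant times \<open>(norm d)\<^sup>2\<close>. The safeguard compensates for this loss. When
  \<open>\<eta> < rhat\<close> one has \<open>\<beta> = \<eta>\<^sup>2 < rhat\<^sup>2\<close>, and every branch of the definition of \<open>\<lambda>\<close> forces
  \<open>\<bar>\<lambda>\<gamma>\<bar> \<le> \<beta> / (1 - \<beta>)\<close> (\<open>safeguarded_gamma_bound\<close>). Since Newton updates are comparable in
  size to the errors, \<open>\<eta>\<close> is at most \<open>3 * norm e / norm d\<close>, and the factor \<open>\<eta>\<^sup>2\<close> turns
  \<open>(norm d)\<^sup>2\<close> into \<open>(norm e)\<^sup>2\<close>. The denominator \<open>1 - rhat\<^sup>2\<close> is all that remains of \<open>rhat\<close>.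
\<close>

section \<open>Lipschitz bounds from continuous differentiability\<close>

lemma C_diff_SucD: "C_diff (Suc k) f \<Longrightarrow> C_diff k f"
proof (induction k arbitrary: f)
  case 0
  then show ?case
    by (auto intro!: continuous_at_imp_continuous_on differentiable_imp_continuous_within)
qed auto

text \<open>
  Continuity of the derivative is given direction by direction. Each directional derivative is
  bounded on the compact ball, and summing over the finite basis bounds the operator norm, which
  the mean value inequality converts into a Lipschitz constant.
\<close>
lemma C1_imp_lipschitz_on_cball:
  fixes g :: "'a::euclidean_space \<Rightarrow> 'b::euclidean_space"
  assumes "C_diff 1 g"
  shows "\<exists>K\<ge>0. \<forall>x\<in>cball a r. \<forall>y\<in>cball a r. norm (g x - g y) \<le> K * norm (x - y)"
proof -
  have diff: "g differentiable (at x)" for x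
    using assms by simp
  define D where "D = (\<lambda>x. frechet_derivative g (at x))"
  have der: "(g has_derivative D x) (at x)" for x
    using diff unfolding D_def by (simp add: frechet_derivative_works)
  have lin: "linear (D x)" for x
    using der has_derivative_linear by blast
  have "\<exists>K. \<forall>x\<in>cball a r. norm (D x v) \<le> K" for v
  proof -
    have "continuous_on (cball a r) (\<lambda>x. D x v)"
      using assms unfolding D_def by (auto intro: continuous_on_subset)
    then have "bounded ((\<lambda>x. D x v) ` cball a r)"
      by (intro compact_imp_bounded compact_continuous_image compact_cball)
    then show ?thesis
      by (auto simp: bounded_iff)
  qed
  then obtain K where K: "\<And>v x. x \<in> cball a r \<Longrightarrow> norm (D x v) \<le> K v"
    by metis
  define B where "B = (\<Sum>b\<in>Basis. \<bar>K b\<bar>)"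
  have B: "norm (D x v) \<le> B * norm v" if "x \<in> cball a r" for x v
  proof -
    have "norm (D x v) = norm (\<Sum>b\<in>Basis. (v \<bullet> b) *\<^sub>R D x b)"
      using linear_sum[OF lin] linear_scale[OF lin] euclidean_representation[of v]
      by (metis (no_types, lifting) sum.cong)
    also have "\<dots> \<le> (\<Sum>b\<in>Basis. norm v * \<bar>K b\<bar>)"
    proof (intro sum_norm_le)
      fix b :: 'a assume "b \<in> Basis"
      then show "norm ((v \<bullet> b) *\<^sub>R D x b) \<le> norm v * \<bar>K b\<bar>"
        using K[OF that, of b] Basis_le_norm[of b v] by (auto intro!: mult_mono)
    qed
    finally show ?thesis
      by (simp add: B_def sum_distrib_left mult.commute)
  qed
  have "norm (g x - g y) \<le> B * norm (x - y)" if "x \<in> cball a r" "y \<in> cball a r" for x y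
  proof (rule differentiable_bound[where S = "cball a r" and f' = D])
    show "(g has_derivative D z) (at z within cball a r)" for z
      using der has_derivative_at_withinI by blast
    show "onorm (D z) \<le> B" if "z \<in> cball a r" for z
      using B[OF that] by (intro onorm_le) auto
  qed (use that in auto)
  moreover have "0 \<le> B"
    unfolding B_def by (intro sum_nonneg) auto
  ultimately show ?thesis
    by blast
qed

lemma C2_imp_derivative_lipschitz_on_cball:
  fixes f :: "'a::euclidean_space \<Rightarrow> 'b::euclidean_space"
  assumes "C_diff 2 f"
  shows "\<exists>L\<ge>0. \<forall>x\<in>cball a r. \<forall>y\<in>cball a r. \<forall>v.
    norm (frechet_derivative f (at x) v - frechet_derivative f (at y) v)
      \<le> L * norm (x - y) * norm v"
proof -
  define D where "D = (\<lambda>x. frechet_derivative f (at x))"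
  have C2: "C_diff (Suc 1) f"
    using assms by (simp add: numeral_2_eq_2)
  then have lin: "linear (D x)" for x
    unfolding D_def by (auto intro: linear_frechet_derivative)
  have "C_diff 1 (\<lambda>x. D x v)" for v
    using C2 unfolding D_def C_diff.simps(2) by blast
  then have "\<exists>K\<ge>0. \<forall>x\<in>cball a r. \<forall>y\<in>cball a r. norm (D x v - D y v) \<le> K * norm (x - y)" for v
    by (rule C1_imp_lipschitz_on_cball)
  then obtain K where K0: "\<And>v. K v \<ge> 0"
    and K: "\<And>v x y. x \<in> cball a r \<Longrightarrow> y \<in> cball a r \<Longrightarrow> norm (D x v - D y v) \<le> K v * norm (x - y)"
    by metis
  define L where "L = (\<Sum>b\<in>Basis. K b)"
  have "norm (D x v - D y v) \<le> L * norm (x - y) * norm v"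
    if "x \<in> cball a r" "y \<in> cball a r" for x y v
  proof -
    have expand: "D z v = (\<Sum>b\<in>Basis. (v \<bullet> b) *\<^sub>R D z b)" for z
      using linear_sum[OF lin] linear_scale[OF lin] euclidean_representation[of v]
      by (metis (no_types, lifting) sum.cong)
    have "norm (D x v - D y v) = norm (\<Sum>b\<in>Basis. (v \<bullet> b) *\<^sub>R (D x b - D y b))"
      by (simp add: expand sum_subtractf scaleR_diff_right)
    also have "\<dots> \<le> (\<Sum>b\<in>Basis. norm v * (K b * norm (x - y)))"
    proof (intro sum_norm_le)
      fix b :: 'a assume "b \<in> Basis"
      then show "norm ((v \<bullet> b) *\<^sub>R (D x b - D y b)) \<le> norm v * (K b * norm (x - y))"
        using K[OF that, of b] Basis_le_norm[of b v] by (auto intro!: mult_mono)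
    qed
    also have "\<dots> = L * norm (x - y) * norm v"
      by (simp add: L_def sum_distrib_left sum_distrib_right algebra_simps)
    finally show ?thesis .
  qed
  moreover have "0 \<le> L"
    unfolding L_def by (intro sum_nonneg K0)
  ultimately show ?thesis
    unfolding D_def by blast
qed

section \<open>Quadratic error of the Newton step\<close>

text \<open>
  Multiplying the Newton error by \<open>f' x\<close> gives
  \<open>f' x (x + newton_update f x - xstar) = f xstar - f x - f' x (xstar - x)\<close>, a linearization error,
  which is quadratic because \<open>f'\<close> is Lipschitz. To undo the multiplication it suffices that
  \<open>f' x\<close> is bounded below, uniformly in \<open>x\<close>; this lower bound survives small perturbations of
  \<open>f' xstar\<close>, and it also makes \<open>f' x\<close> invertible.
\<close>
lemma newton_error_quadratic:
  fixes f :: "real^'n \<Rightarrow> real^'n"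
  assumes "C_diff 2 f" and zero: "f xstar = 0" and inv: "invertible (jacobian f (at xstar))"
  shows "\<exists>\<delta>>0. \<exists>C\<ge>0. \<forall>x\<in>ball xstar \<delta>.
    norm (x + newton_update f x - xstar) \<le> C * (norm (x - xstar))\<^sup>2"
proof -
  define J where "J = (\<lambda>x. jacobian f (at x))"
  have diff: "f differentiable (at x)" for x
    using assms(1) by (simp add: numeral_2_eq_2)
  then have der: "(f has_derivative (\<lambda>v. J x *v v)) (at x)" for x
    unfolding J_def using jacobian_works by blast
  have J: "frechet_derivative f (at x) = (\<lambda>v. J x *v v)" for x
    using frechet_derivative_at[OF der] by simp
  obtain L where L0: "L \<ge> 0" and L: "\<And>x y v. x \<in> cball xstar 1 \<Longrightarrow> y \<in> cball xstar 1 \<Longrightarrow>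
      norm (J x *v v - J y *v v) \<le> L * norm (x - y) * norm v"
    using C2_imp_derivative_lipschitz_on_cball[OF assms(1), of xstar 1] unfolding J by blast
  have "inj ((*v) (J xstar))"
    using inv unfolding J_def by (simp add: inj_matrix_vector_mult)
  then obtain m where m0: "m > 0" and m: "\<And>v. norm (J xstar *v v) \<ge> m * norm v"
    using linear_inj_bounded_below_pos[OF matrix_vector_mul_linear, of "J xstar"]
    by (metis mult.commute)
  \<comment> \<open>Within this radius \<open>J x\<close> differs from \<open>J xstar\<close> by at most \<open>m / 2\<close>.\<close>
  define \<delta> where "\<delta> = min 1 (m / (2 * (L + 1)))"
  have "\<delta> > 0"
    using m0 L0 by (simp add: \<delta>_def)
  have "norm (x + newton_update f x - xstar) \<le> 2 * L / m * (norm (x - xstar))\<^sup>2"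
    if x: "x \<in> ball xstar \<delta>" for x
  proof -
    have xe: "norm (x - xstar) < \<delta>"
      using x by (simp add: dist_norm norm_minus_commute)
    have x1: "x \<in> cball xstar 1"
      using xe by (simp add: \<delta>_def dist_norm norm_minus_commute)
    have "L * norm (x - xstar) \<le> (L + 1) * (m / (2 * (L + 1)))"
      using xe L0 by (intro mult_mono) (auto simp: \<delta>_def)
    also have "\<dots> = m / 2"
      using L0 by (simp add: field_simps)
    finally have small: "L * norm (x - xstar) \<le> m / 2" .
    have below: "m / 2 * norm v \<le> norm (J x *v v)" for v
    proof -
      have "norm (J x *v v - J xstar *v v) \<le> m / 2 * norm v"
        using L[of x xstar v] x1 mult_right_mono[OF small, of "norm v"] by auto
      then show ?thesis
        using m[of v] norm_triangle_ineq2[of "J xstar *v v" "J x *v v"]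
        by (simp add: norm_minus_commute)
    qed
    have "\<forall>v. J x *v v = 0 \<longrightarrow> v = 0"
    proof (intro allI impI)
      fix v assume "J x *v v = 0"
      then show "v = 0"
        using below[of v] m0 by (simp add: mult_le_0_iff)
    qed
    then have "invertible (J x)"
      using matrix_left_invertible_ker invertible_left_inverse by blast
    then have invx: "J x ** matrix_inv (J x) = mat 1"
      unfolding invertible_def matrix_inv_def by (rule someI2_ex) simp
    have "J x *v (x + newton_update f x - xstar) = J x *v (x - xstar) - f x"
    proof -
      have "J x *v newton_update f x = - f x"
        using invx vec.neg[of "J x"]
        by (simp add: newton_update_def J_def matrix_vector_mul_assoc)
      then show ?thesis
        by (simp add: algebra_simps matrix_vector_mult_diff_distrib matrix_vector_right_distrib)
    qed
    also have "\<dots> = f xstar - f x - J x *v (xstar - x)"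
      using zero by (simp add: matrix_vector_mult_diff_distrib)
    finally have eq: "J x *v (x + newton_update f x - xstar)
        = f xstar - f x - J x *v (xstar - x)" .
    have "norm (f xstar - f x - J x *v (xstar - x))
        \<le> norm (xstar - x) * (L * norm (x - xstar))"
    proof (rule differentiable_bound_linearization[where S = "closed_segment x xstar"
            and f' = "\<lambda>z v. J z *v v"])
      show "x + t *\<^sub>R (xstar - x) \<in> closed_segment x xstar" if "t \<in> {0..1}" for t
        using that by (auto simp: closed_segment_def algebra_simps intro!: exI[of _ t])
      show "(f has_derivative (*v) (J z)) (at z within closed_segment x xstar)" for z
        using der has_derivative_at_withinI by blast
      fix z assume z: "z \<in> closed_segment x xstar"
      then have z1: "z \<in> cball xstar 1"
        using x1 closed_segment_subset[of x "cball xstar 1" xstar] by auto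
      have "norm (z - x) \<le> norm (x - xstar)"
        using segment_bound(1)[OF z] by (simp add: norm_minus_commute)
      then have "L * norm (z - x) * norm v \<le> L * norm (x - xstar) * norm v" for v :: "real^'n"
        using L0 by (intro mult_left_mono mult_right_mono) auto
      then show "onorm ((*v) (J z) - (*v) (J x)) \<le> L * norm (x - xstar)"
        using L[OF z1 x1] by (intro onorm_le) (auto intro: order_trans)
    qed auto
    with eq below[of "x + newton_update f x - xstar"]
    have "m / 2 * norm (x + newton_update f x - xstar) \<le> L * (norm (x - xstar))\<^sup>2"
      by (simp add: power2_eq_square norm_minus_commute mult_ac)
    then show ?thesis
      using m0 by (simp add: field_simps)
  qed
  then show ?thesis
    using \<open>\<delta> > 0\<close> L0 m0 by (intro exI[of _ \<delta>] conjI exI[of _ "2 * L / m"]) auto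
qed

section \<open>Size of the safeguarded extrapolation coefficient\<close>

text \<open>
  Truncation produces \<open>\<beta> / (\<beta> + sgn \<gamma>)\<close>, whose denominator has absolute value at least \<open>1 - \<beta>\<close>.
  If \<open>\<gamma>\<close> is left as it is, the test gives \<open>\<bar>\<gamma>\<bar> \<le> \<beta> * \<bar>1 - \<gamma>\<bar> \<le> \<beta> * (1 + \<bar>\<gamma>\<bar>)\<close>, which
  is the same bound after solving for \<open>\<bar>\<gamma>\<bar>\<close>.
\<close>
lemma safeguarded_gamma_bound:
  assumes "0 \<le> \<beta>" "\<beta> < 1"
  shows "\<bar>safeguard_lambda \<beta> \<gamma> * \<gamma>\<bar> \<le> \<beta> / (1 - \<beta>)"
proof -
  consider "\<gamma> = 0 \<or> \<gamma> \<ge> 1" | "\<gamma> \<noteq> 0" "\<gamma> < 1" "\<bar>\<gamma>\<bar> / \<bar>1 - \<gamma>\<bar> > \<beta>"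
    | "\<gamma> \<noteq> 0" "\<gamma> < 1" "\<bar>\<gamma>\<bar> / \<bar>1 - \<gamma>\<bar> \<le> \<beta>"
    by linarith
  then show ?thesis
  proof cases
    case 1
    then show ?thesis
      using assms by (auto simp: safeguard_lambda_def)
  next
    case 2
    then have "\<bar>safeguard_lambda \<beta> \<gamma> * \<gamma>\<bar> = \<beta> / \<bar>\<beta> + sgn \<gamma>\<bar>"
      using assms by (simp add: safeguard_lambda_def abs_mult)
    also have "\<dots> \<le> \<beta> / (1 - \<beta>)"
      using assms 2(1) by (intro divide_left_mono) (auto simp: sgn_if abs_if)
    finally show ?thesis .
  next
    case 3
    then have "\<bar>\<gamma>\<bar> \<le> \<beta> * \<bar>1 - \<gamma>\<bar>"
      by (simp add: field_simps)
    also have "\<dots> \<le> \<beta> * (1 + \<bar>\<gamma>\<bar>)"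
      using assms by (intro mult_left_mono) auto
    finally have "\<bar>\<gamma>\<bar> \<le> \<beta> / (1 - \<beta>)"
      using assms by (simp add: field_simps)
    then show ?thesis
      using 3 by (simp add: safeguard_lambda_def)
  qed
qed

lemma na_lambda_gamma_bound:
  assumes "na_eta f x y < rhat" "rhat < 1"
  shows "\<bar>na_lambda rhat f x y * na_gamma f x y\<bar> \<le> (na_eta f x y)\<^sup>2 / (1 - rhat\<^sup>2)"
proof -
  let ?\<eta> = "na_eta f x y"
  have \<eta>0: "0 \<le> ?\<eta>"
    by (simp add: na_eta_def)
  have \<beta>: "na_beta rhat f x y = ?\<eta>\<^sup>2"
    using assms by (simp add: na_beta_def power2_eq_square)
  have le: "?\<eta>\<^sup>2 \<le> rhat\<^sup>2" and lt: "rhat\<^sup>2 < 1"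
    using assms \<eta>0 by (auto intro: power_mono simp: power_less_one_iff)
  have "\<bar>na_lambda rhat f x y * na_gamma f x y\<bar> \<le> ?\<eta>\<^sup>2 / (1 - ?\<eta>\<^sup>2)"
    unfolding na_lambda_def \<beta> using le lt by (intro safeguarded_gamma_bound) auto
  also have "\<dots> \<le> ?\<eta>\<^sup>2 / (1 - rhat\<^sup>2)"
    using le lt by (intro divide_left_mono) auto
  finally show ?thesis .
qed

section \<open>Convergence of the safeguarded step\<close>

theorem corollary3p1:
  fixes f :: "real^'n \<Rightarrow> real^'n" and xstar :: "real^'n"
  assumes "C_diff 3 f"
    and "f xstar = 0"
    and "invertible (jacobian f (at xstar))"
  shows "\<exists>\<rho>>0. \<exists>C1 C2 :: real. \<forall>rhat\<in>{0<..<1}. \<forall>x y.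
           x \<in> ball xstar \<rho> \<longrightarrow> y \<in> ball xstar \<rho> \<longrightarrow>
           norm (x - xstar) < norm (y - xstar) \<longrightarrow>
           na_eta f x y < rhat \<longrightarrow>
           norm (safeguarded_na_step rhat f x y - xstar)
             \<le> (C1 / (1 - rhat\<^sup>2) + C2) * (norm (x - xstar))\<^sup>2"
proof -
  have "C_diff 2 f"
    using assms(1) C_diff_SucD[of 2 f] by simp
  then obtain \<delta> C where \<delta>: "\<delta> > 0" and C0: "C \<ge> 0"
    and C: "\<And>x. x \<in> ball xstar \<delta> \<Longrightarrow>
      norm (x + newton_update f x - xstar) \<le> C * (norm (x - xstar))\<^sup>2"
    using newton_error_quadratic assms(2,3) by blast
  \<comment> \<open>Within this radius Newton's step at least halves the error.\<close>
  define \<rho> where "\<rho> = min \<delta> (1 / (2 * (C + 1)))"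
  have halve: "norm (z + newton_update f z - xstar) \<le> norm (z - xstar) / 2"
    if z: "z \<in> ball xstar \<rho>" for z
  proof -
    have "C * norm (z - xstar) \<le> (C + 1) * (1 / (2 * (C + 1)))"
      using z C0 by (intro mult_mono) (auto simp: \<rho>_def dist_norm norm_minus_commute)
    also have "\<dots> = 1 / 2"
      using C0 by (simp add: field_simps)
    finally have "C * norm (z - xstar) * norm (z - xstar) \<le> 1 / 2 * norm (z - xstar)"
      by (rule mult_right_mono) simp
    moreover have "z \<in> ball xstar \<delta>"
      using z by (simp add: \<rho>_def)
    ultimately show ?thesis
      using C[of z] by (simp add: power2_eq_square mult.assoc)
  qed
  have main: "norm (safeguarded_na_step rhat f x y - xstar)
      \<le> (18 * C / (1 - rhat\<^sup>2) + C) * (norm (x - xstar))\<^sup>2"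
    if rhat: "rhat \<in> {0<..<1}" and x: "x \<in> ball xstar \<rho>" and y: "y \<in> ball xstar \<rho>"
      and less: "norm (x - xstar) < norm (y - xstar)" and eta: "na_eta f x y < rhat"
    for rhat x y
  proof -
    define h where "h = (\<lambda>z. z + newton_update f z - xstar)"
    define e where "e = norm (x - xstar)"
    define d where "d = norm (y - xstar)"
    define \<eta> where "\<eta> = na_eta f x y"
    define t where "t = na_lambda rhat f x y * na_gamma f x y"
    have e0: "0 \<le> e" and ed: "e < d"
      using less by (auto simp: e_def d_def)
    have r: "0 < 1 - rhat\<^sup>2"
      using rhat by (simp add: power_less_one_iff)
    have hx: "norm (h x) \<le> C * e\<^sup>2" and hy: "norm (h y) \<le> C * d\<^sup>2"
      using C[of x] C[of y] x y by (auto simp: h_def e_def d_def \<rho>_def)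
    have "norm (newton_update f x) = norm (h x - (x - xstar))"
      by (simp add: h_def)
    also have "\<dots> \<le> 3 / 2 * e"
      using norm_triangle_ineq4[of "h x" "x - xstar"] halve[OF x] by (simp add: h_def e_def)
    finally have up: "norm (newton_update f x) \<le> 3 / 2 * e" .
    have "d / 2 \<le> norm ((y - xstar) - h y)"
      using norm_triangle_ineq2[of "y - xstar" "h y"] halve[OF y] by (simp add: h_def d_def)
    also have "\<dots> = norm (newton_update f y)"
      by (simp add: h_def)
    finally have low: "d / 2 \<le> norm (newton_update f y)" .
    have "\<eta> \<le> (3 / 2 * e) / (d / 2)"
      unfolding \<eta>_def na_eta_def using up low e0 ed by (intro frac_le) auto
    then have "\<eta> * d \<le> 3 * e"
      using e0 ed by (simp add: field_simps)
    moreover have "0 \<le> \<eta>"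
      by (simp add: \<eta>_def na_eta_def)
    ultimately have "(\<eta> * d)\<^sup>2 \<le> (3 * e)\<^sup>2"
      using e0 ed by (intro power_mono) auto
    then have etad: "\<eta>\<^sup>2 * d\<^sup>2 \<le> 9 * e\<^sup>2"
      by (simp add: power_mult_distrib)
    have t: "\<bar>t\<bar> \<le> \<eta>\<^sup>2 / (1 - rhat\<^sup>2)"
      unfolding t_def \<eta>_def using eta rhat by (intro na_lambda_gamma_bound) auto
    have "C * e\<^sup>2 \<le> C * d\<^sup>2"
      using C0 e0 ed by (intro mult_left_mono power_mono) auto
    then have hxy: "norm (h x - h y) \<le> 2 * C * d\<^sup>2"
      using norm_triangle_ineq4[of "h x" "h y"] hx hy by linarith
    have "norm (t *\<^sub>R (h x - h y)) \<le> \<eta>\<^sup>2 / (1 - rhat\<^sup>2) * (2 * C * d\<^sup>2)"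
      using mult_mono[OF t hxy] r by simp
    also have "\<dots> = 2 * C / (1 - rhat\<^sup>2) * (\<eta>\<^sup>2 * d\<^sup>2)"
      by simp
    also have "\<dots> \<le> 2 * C / (1 - rhat\<^sup>2) * (9 * e\<^sup>2)"
      using etad C0 r by (intro mult_left_mono) auto
    finally have corr: "norm (t *\<^sub>R (h x - h y)) \<le> 18 * C / (1 - rhat\<^sup>2) * e\<^sup>2"
      by simp
    have "safeguarded_na_step rhat f x y - xstar = h x - t *\<^sub>R (h x - h y)"
      by (simp add: safeguarded_na_step_def h_def t_def algebra_simps)
    then have "norm (safeguarded_na_step rhat f x y - xstar)
        \<le> norm (h x) + norm (t *\<^sub>R (h x - h y))"
      using norm_triangle_ineq4 by metis
    also have "\<dots> \<le> C * e\<^sup>2 + 18 * C / (1 - rhat\<^sup>2) * e\<^sup>2"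
      using hx corr by linarith
    finally show ?thesis
      by (simp add: e_def distrib_right add.commute)
  qed
  have "\<rho> > 0"
    using \<delta> C0 by (simp add: \<rho>_def)
  with main show ?thesis
    by (intro exI[of _ \<rho>] conjI exI[of _ "18 * C"] exI[of _ C]) auto
qed

end
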